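(* Let $X$ be a closed and convex subset of a uniformly convex normed space $(\widetilde{X},|\cdot|)$, and let $p\in X$. Suppose that there exists some $s>0$ such that $p+s\theta\in X$ for each $\theta\in\Theta_p$. Suppose also that $p$ has the emanation property. Let $\emptyset\neq A\subset X$ be such that $d(p,A)>0$, and suppose that there exists $\rho\in(0,\infty)$ such that for every $x\in X$ the open ball $B(x,\rho)$ intersects $A$. Then $\operatorname{dom}(p,A)$ is homeomorphic to the set $$B_p=\{r\theta: r\in[0,1],\ \theta\in\Theta_p\},$$ and, in particular, $\operatorname{dom}(p,A)$ is path connected and locally path connected.
   Context: Normed spaces may be real or complex, finite or infinite dimensional; $d(x,y)=|x-y|$ is the induced metric and $d(x,A)=\inf\{d(x,a):a\in A\}$. $B(x,r)$ is the open ball of center $x$ and radius $r$. All subsets carry the topology induced by the norm. A normed space is uniformly convex if for every $\epsilon\in(0,2]$ there is $\delta\in(0,1]$ such that $|x|=|y|=1$ and $|x-y|\ge\epsilon$ imply $|(x+y)/2|\le 1-\delta$. Dominance region: for $p\in X$ and nonempty $A\subseteq X$, $\operatorname{dom}(p,A)=\{x\in X: d(x,p)\le d(x,A)\}$. For $p\in X$, $\Theta_p=\{\theta:|\theta|=1,\ p+t\theta\in X\text{ for some }t>0\}$. Emanation property: for $\theta\in\Theta_p$ let $L(\theta)\in(0,\infty]$ be the length of the intersection of $X$ with the ray emanating from $p$ in the direction $\theta$. The point $p$ has the emanation property in the direction $\theta\in\Theta_p$ if for each $\epsilon>0$ there exists $\beta>0$ such that every $\phi\in\Theta_p$ with $|\phi-\theta|<\beta$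 satisfies $L(\phi)\ge L(\theta)-\epsilon$. The point $p$ has the emanation property if it has it in the direction of every $\theta\in\Theta_p$. A topological space is locally path connected if for every point $x$ and every open $U\ni x$ there is a path connected open $V\subseteq U$ with $x\in V$. *)

theory Defs
  imports "HOL-Analysis.Analysis"
begin

text \<open>
  The class \<^class>\<open>real_normed_vector\<close> covers real and complex normed spaces alike (a complex normed
  space is in particular a real one, and everything below involves only the norm and
  multiplication by real scalars). Completeness and finite dimension are not assumed.
\<close>

definition uniformly_convex :: "'a::real_normed_vector itself \<Rightarrow> bool" where
  "uniformly_convex _ \<longleftrightarrow>
     (\<forall>\<epsilon>\<in>{0<..2}. \<exists>\<delta>\<in>{0<..1::real}. \<forall>x y::'a.
        norm x = 1 \<and> norm y = 1 \<and> norm (x - y) \<ge> \<epsilon> \<longrightarrow> norm ((x + y) /\<^sub>R 2) \<le> 1 - \<delta>)"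

definition dominance_region :: "'a::real_normed_vector set \<Rightarrow> 'a \<Rightarrow> 'a set \<Rightarrow> 'a set" where
  "dominance_region X p A = {x \<in> X. dist x p \<le> infdist x A}"

definition directions :: "'a::real_normed_vector set \<Rightarrow> 'a \<Rightarrow> 'a set" where
  "directions X p = {\<theta>. norm \<theta> = 1 \<and> (\<exists>t>0. p + t *\<^sub>R \<theta> \<in> X)}"

text \<open>
  For a unit vector \<open>\<theta>\<close> the map \<open>t \<mapsto> p + t *\<^sub>R \<theta>\<close> parametrises the ray from \<open>p\<close> isometrically, so
  the length of the part of the ray in \<open>X\<close> is the Lebesgue measure of its parameter set (a closed
  interval when \<open>X\<close> is closed and convex); it is \<open>\<infinity>\<close> when the whole ray lies in \<open>X\<close>.
\<close>

definition ray_length :: "'a::real_normed_vector set \<Rightarrow> 'a \<Rightarrow> 'a \<Rightarrow> ennreal" where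
  "ray_length X p \<theta> = emeasure lborel {t::real. 0 \<le> t \<and> p + t *\<^sub>R \<theta> \<in> X}"

text \<open>
  Subtraction on \<^typ>\<open>ennreal\<close> is truncated at \<open>0\<close>, which does not affect a lower bound on the
  nonnegative left-hand side, and \<open>\<infinity> - ennreal \<epsilon> = \<infinity>\<close>.
\<close>

definition emanation_in_direction :: "'a::real_normed_vector set \<Rightarrow> 'a \<Rightarrow> 'a \<Rightarrow> bool" where
  "emanation_in_direction X p \<theta> \<longleftrightarrow>
     (\<forall>\<epsilon>::real>0. \<exists>\<beta>>0. \<forall>\<phi>\<in>directions X p. norm (\<phi> - \<theta>) < \<beta> \<longrightarrow>
        ray_length X p \<phi> \<ge> ray_length X p \<theta> - ennreal \<epsilon>)"

definition emanation_property :: "'a::real_normed_vector set \<Rightarrow> 'a \<Rightarrow> bool" where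
  "emanation_property X p \<longleftrightarrow> (\<forall>\<theta>\<in>directions X p. emanation_in_direction X p \<theta>)"

definition direction_cone :: "'a::real_normed_vector set \<Rightarrow> 'a \<Rightarrow> 'a set" where
  "direction_cone X p = {r *\<^sub>R \<theta> | r \<theta>. r \<in> {0..1} \<and> \<theta> \<in> directions X p}"

end

theory Submission
  imports Defs
begin

text \<open>
  The dominance region is closed, bounded and star-shaped about \<open>p\<close>, so it is determined by the
  length \<open>T \<theta>\<close> of its intersection with each ray, and the radial map \<open>r *\<^sub>R \<theta> \<mapsto> p + (r * T \<theta>) *\<^sub>R \<theta>\<close> is a
  homeomorphism as soon as \<open>T\<close> is continuous and bounded away from \<open>0\<close> and \<open>\<infinity>\<close>. Closedness gives upper
  semicontinuity. For lower semicontinuity, let \<open>t < T \<theta>\<close>: if some \<open>a \<in> A\<close> had distance almost \<open>t\<close>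
  from \<open>p + t *\<^sub>R \<theta>\<close>, then its distance to \<open>p + T \<theta> *\<^sub>R \<theta>\<close> would almost attain the triangle inequality,
  and uniform convexity would force \<open>a\<close> to be close to \<open>p\<close>. Hence \<open>t\<close> is strictly less than the distance
  to \<open>A\<close>, which persists for nearby directions, while the emanation property keeps the points in \<open>X\<close>.
  The direction cone is convex, being the unit ball cut by the convex cone generated by \<open>X - p\<close>;
  this gives both forms of path connectedness.
\<close>

section \<open>Uniform convexity and the strict gap along a segment\<close>

text \<open>Splitting off a common coefficient \<open>m\<close> leaves nonnegative multiples of
  \<open>u\<close> and \<open>v\<close>, for which the triangle inequality suffices. In this way the
  deficit that uniform convexity gives for \<open>u + v\<close> passes to sums with unequal
  coefficients.\<close>

lemma norm_scaled_add_le: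
  fixes u v :: "'a::real_normed_vector"
  assumes "norm u = 1" "norm v = 1" "0 \<le> m" "m \<le> \<alpha>" "m \<le> \<tau>"
  shows "norm (\<alpha> *\<^sub>R u + \<tau> *\<^sub>R v) \<le> m * norm (u + v) + (\<alpha> + \<tau> - 2 * m)"
proof -
  have "\<alpha> *\<^sub>R u + \<tau> *\<^sub>R v = m *\<^sub>R (u + v) + ((\<alpha> - m) *\<^sub>R u + (\<tau> - m) *\<^sub>R v)"
    by (simp add: algebra_simps)
  also have "norm \<dots> \<le> norm (m *\<^sub>R (u + v)) + (norm ((\<alpha> - m) *\<^sub>R u) + norm ((\<tau> - m) *\<^sub>R v))"
    by (intro order.trans[OF norm_triangle_ineq] add_left_mono norm_triangle_ineq)
  also have "\<dots> = m * norm (u + v) + (\<alpha> + \<tau> - 2 * m)"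
    using assms by simp
  finally show ?thesis .
qed

text \<open>The infimum over \<open>A\<close> need not be attained, so strictness at each single
  \<open>a\<close> would not be enough; the proof finds one margin \<open>\<eta>\<close> that serves
  all of \<open>A\<close>.\<close>

lemma uniformly_convex_infdist_segment_gap:
  fixes A :: "'a::real_normed_vector set"
  assumes uc: "uniformly_convex TYPE('a)" and ne: "A \<noteq> {}" and pos: "infdist p A > 0"
    and unit: "norm \<theta> = 1" and t: "0 < t" "t < T" and far: "T \<le> infdist (p + T *\<^sub>R \<theta>) A"
  shows "t < infdist (p + t *\<^sub>R \<theta>) A"
proof -
  define d where "d = infdist p A"
  \<comment> \<open>A direction error below \<open>\<epsilon>\<close> displaces a point at distance
    \<open>t\<close> by less than \<open>d / 2\<close>; the cap 2 is the range of the modulus of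
    convexity.\<close>
  define \<epsilon> where "\<epsilon> = min 2 (d / (2 * t))"
  have \<epsilon>: "0 < \<epsilon>" "\<epsilon> \<le> 2" and t\<epsilon>: "t * \<epsilon> \<le> d / 2"
    using pos t by (auto simp: \<epsilon>_def d_def min_def field_simps)
  obtain \<delta> where \<delta>: "0 < \<delta>"
    and conv: "\<And>x y::'a. norm x = 1 \<Longrightarrow> norm y = 1 \<Longrightarrow> norm (x - y) \<ge> \<epsilon>
      \<Longrightarrow> norm ((x + y) /\<^sub>R 2) \<le> 1 - \<delta>"
    using uc \<epsilon> unfolding uniformly_convex_def by (fastforce dest!: bspec[where x = \<epsilon>])
  \<comment> \<open>\<open>m\<close> bounds from below both coefficients \<open>T - t\<close> and
    \<open>\<tau>\<close> in the sum estimated below. The two bounds on \<open>\<eta>\<close> serve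
    the two contradictions: \<open>m * \<delta>\<close> the one on directions, \<open>d / 2\<close>
    the final one with \<open>d \<le> dist p a\<close>.\<close>
  define m where "m = min (T - t) t"
  define \<eta> where "\<eta> = min (d / 2) (m * \<delta>)"
  have m: "0 < m" "m \<le> T - t" "m \<le> t" using t by (auto simp: m_def)
  have \<eta>: "0 < \<eta>" "\<eta> \<le> d / 2" "\<eta> \<le> m * \<delta>" using m \<delta> pos by (auto simp: \<eta>_def d_def)
  have "t + \<eta> \<le> dist (p + t *\<^sub>R \<theta>) a" if a: "a \<in> A" for a
  proof (rule ccontr)
    define w where "w = p + t *\<^sub>R \<theta> - a"
    define \<tau> where "\<tau> = norm w"
    define u where "u = w /\<^sub>R \<tau>"
    assume "\<not> t + \<eta> \<le> dist (p + t *\<^sub>R \<theta>) a"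
    then have up: "\<tau> < t + \<eta>" by (simp add: \<tau>_def w_def dist_norm)
    have "T \<le> dist (p + T *\<^sub>R \<theta>) a"
      using far infdist_le[OF a, of "p + T *\<^sub>R \<theta>"] by linarith
    also have "\<dots> = norm ((T - t) *\<^sub>R \<theta> + w)"
      by (simp add: dist_norm w_def algebra_simps)
    finally have T: "T \<le> norm ((T - t) *\<^sub>R \<theta> + w)" .
    have "norm ((T - t) *\<^sub>R \<theta> + w) \<le> (T - t) + \<tau>"
      using norm_triangle_ineq[of "(T - t) *\<^sub>R \<theta>" w] t unit by (simp add: \<tau>_def)
    with T have \<tau>: "t \<le> \<tau>" by linarith
    have "\<tau> \<noteq> 0" using \<tau> t by linarith
    then have w: "w = \<tau> *\<^sub>R u" and u: "norm u = 1" by (simp_all add: u_def) (simp add: \<tau>_def)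
    \<comment> \<open>Otherwise convexity shortens the path from \<open>a\<close> to
      \<open>p + T *\<^sub>R \<theta>\<close> by \<open>2 * (m * \<delta>)\<close>, more than the
      excess \<open>\<tau> - t < \<eta>\<close> can pay for.\<close>
    have "norm (\<theta> - u) < \<epsilon>"
    proof (rule ccontr)
      assume "\<not> norm (\<theta> - u) < \<epsilon>"
      then have "norm (\<theta> + u) \<le> 2 - 2 * \<delta>"
        using conv[OF unit u] by simp
      then have "m * norm (\<theta> + u) \<le> m * (2 - 2 * \<delta>)" using m by simp
      moreover have "norm ((T - t) *\<^sub>R \<theta> + w) \<le> m * norm (\<theta> + u) + ((T - t) + \<tau> - 2 * m)"
        unfolding w using m \<tau> by (intro norm_scaled_add_le unit u) auto
      ultimately have "T \<le> T - t + \<tau> - 2 * (m * \<delta>)"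
        using T by (simp add: algebra_simps)
      then show False using up \<eta> mult_pos_pos[OF m(1) \<delta>] by linarith
    qed
    then have "t * norm (u - \<theta>) < t * \<epsilon>" using t by (simp add: norm_minus_commute)
    \<comment> \<open>The first term has norm \<open>\<tau> - t < \<eta>\<close>, the second less
      than \<open>d / 2\<close>, so \<open>a\<close> would be too close to \<open>p\<close>.\<close>
    moreover have "p - a = (\<tau> - t) *\<^sub>R u + t *\<^sub>R (u - \<theta>)"
      using w by (simp add: w_def algebra_simps)
    then have "norm (p - a) \<le> (\<tau> - t) + t * norm (u - \<theta>)"
      using norm_triangle_ineq[of "(\<tau> - t) *\<^sub>R u" "t *\<^sub>R (u - \<theta>)"] \<tau> t u by simp
    ultimately have "dist p a < \<eta> + d / 2" using up t\<epsilon> by (simp add: dist_norm)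
    moreover have "d \<le> dist p a" using infdist_le[OF a] by (simp add: d_def)
    ultimately show False using \<eta> by linarith
  qed
  then have "t + \<eta> \<le> infdist (p + t *\<^sub>R \<theta>) A"
    using ne by (auto simp: infdist_def intro!: cINF_greatest)
  then show ?thesis using \<eta> by linarith
qed

section \<open>Radial rescalings as homeomorphisms\<close>

text \<open>Away from the origin \<open>sgn\<close> is continuous; at the origin it is not, and
  there the bound on \<open>g\<close> forces the limit 0.\<close>

lemma continuous_on_radial_rescaling:
  fixes \<Theta> :: "'a::real_normed_vector set" and g :: "'a \<Rightarrow> real"
  assumes g: "continuous_on \<Theta> g" and bd: "\<And>\<theta>. \<theta> \<in> \<Theta> \<Longrightarrow> \<bar>g \<theta>\<bar> \<le> C"
    and S: "\<And>z. z \<in> S \<Longrightarrow> z = 0 \<or> sgn z \<in> \<Theta>"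
  shows "continuous_on S (\<lambda>z. g (sgn z) *\<^sub>R z)"
  unfolding continuous_on_def
proof
  fix z assume z: "z \<in> S"
  show "((\<lambda>z. g (sgn z) *\<^sub>R z) \<longlongrightarrow> g (sgn z) *\<^sub>R z) (at z within S)"
  proof (cases "z = 0")
    case True
    have bound: "norm (g (sgn y) *\<^sub>R y) \<le> C * norm y" if "y \<in> S" for y
    proof (cases "y = 0")
      case False
      then have "\<bar>g (sgn y)\<bar> * norm y \<le> C * norm y"
        using S[OF that] bd by (intro mult_right_mono) auto
      then show ?thesis by simp
    qed simp
    have "((\<lambda>y. C * norm y) \<longlongrightarrow> C * norm z) (at z within S)"
      by (intro tendsto_intros)
    then have "((\<lambda>y. C * norm y) \<longlongrightarrow> 0) (at z within S)" using True by simp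
    moreover have "\<forall>\<^sub>F y in at z within S. norm (g (sgn y) *\<^sub>R y) \<le> C * norm y"
      unfolding eventually_at_filter using bound by (intro always_eventually) blast
    ultimately have "((\<lambda>y. g (sgn y) *\<^sub>R y) \<longlongrightarrow> 0) (at z within S)"
      by (rule Lim_null_comparison[rotated])
    then show ?thesis using True by simp
  next
    case False
    have "continuous_on (S - {0}) (\<lambda>z. g (sgn z) *\<^sub>R z)"
      using S by (intro continuous_on_scaleR continuous_on_compose2[OF g] continuous_on_id)
        (auto simp: sgn_div_norm intro!: continuous_intros)
    moreover have "at z within (S - {0}) = at z within S"
      using False by (intro at_within_nhd[of _ "- {0}"]) auto
    ultimately show ?thesis
      using z False unfolding continuous_on_def by (metis Diff_iff singletonD)
  qed
qed

text \<open>Both the map and its inverse are radial rescalings, with factors \<open>T\<close> and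
  \<open>inverse (T _)\<close>. The bound \<open>C\<close> controls the first near the origin and
  \<open>c\<close> the second. Since \<open>sgn 0 = 0\<close> is not a unit vector, the factor used
  there is arbitrary, but it multiplies the zero vector.\<close>

lemma radial_homeomorphic_cone:
  fixes \<Theta> :: "'a::real_normed_vector set" and T :: "'a \<Rightarrow> real"
  assumes unit: "\<And>\<theta>. \<theta> \<in> \<Theta> \<Longrightarrow> norm \<theta> = 1" and T: "continuous_on \<Theta> T"
    and c: "0 < c" and bounds: "\<And>\<theta>. \<theta> \<in> \<Theta> \<Longrightarrow> c \<le> T \<theta> \<and> T \<theta> \<le> C"
  shows "{p + t *\<^sub>R \<theta> | t \<theta>. \<theta> \<in> \<Theta> \<and> 0 \<le> t \<and> t \<le> T \<theta>}
    homeomorphic {r *\<^sub>R \<theta> | r \<theta>. r \<in> {0..1} \<and> \<theta> \<in> \<Theta>}"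
    (is "?D homeomorphic ?B")
proof -
  define F where "F z = p + T (sgn z) *\<^sub>R z" for z
  define G where "G x = inverse (T (sgn (x - p))) *\<^sub>R (x - p)" for x
  have pos: "0 < T \<theta>" if "\<theta> \<in> \<Theta>" for \<theta> using bounds[OF that] c by linarith
  have sgn: "sgn (t *\<^sub>R \<theta>) = \<theta>" if "\<theta> \<in> \<Theta>" "0 < t" for t :: real and \<theta>
    using unit[OF that(1)] that(2) by (simp add: sgn_div_norm)
  have "continuous_on ?B (\<lambda>z. T (sgn z) *\<^sub>R z)"
  proof (rule continuous_on_radial_rescaling[OF T])
    show "\<bar>T \<theta>\<bar> \<le> C" if "\<theta> \<in> \<Theta>" for \<theta> using pos[OF that] bounds[OF that] by linarith
    show "z = 0 \<or> sgn z \<in> \<Theta>" if "z \<in> ?B" for z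
      using that sgn by (force simp: less_le)
  qed
  then have contF: "continuous_on ?B F"
    unfolding F_def by (intro continuous_on_add continuous_on_const)
  have "continuous_on ((\<lambda>x. x - p) ` ?D) (\<lambda>z. inverse (T (sgn z)) *\<^sub>R z)"
  proof (rule continuous_on_radial_rescaling)
    show "continuous_on \<Theta> (\<lambda>\<theta>. inverse (T \<theta>))"
      using pos by (intro continuous_intros T) force
    show "\<bar>inverse (T \<theta>)\<bar> \<le> inverse c" if "\<theta> \<in> \<Theta>" for \<theta>
      using pos[OF that] bounds[OF that] c by (simp add: le_imp_inverse_le)
    show "z = 0 \<or> sgn z \<in> \<Theta>" if "z \<in> (\<lambda>x. x - p) ` ?D" for z
      using that sgn by (force simp: less_le)
  qed
  then have contG: "continuous_on ?D G"
    unfolding G_def by (rule continuous_on_compose2) (auto intro!: continuous_intros)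
  have FG: "F (G (p + t *\<^sub>R \<theta>)) = p + t *\<^sub>R \<theta> \<and> G (p + t *\<^sub>R \<theta>) \<in> ?B"
    if "\<theta> \<in> \<Theta>" "0 \<le> t" "t \<le> T \<theta>" for t \<theta>
  proof (cases "t = 0")
    case True
    have "0 = (0::real) *\<^sub>R \<theta>" by simp
    then show ?thesis using True that(1) by (force simp: F_def G_def)
  next
    case False
    then have "G (p + t *\<^sub>R \<theta>) = (t / T \<theta>) *\<^sub>R \<theta>"
      using that sgn[OF that(1), of t] by (simp add: G_def field_simps)
    moreover have "0 < t / T \<theta>" "t / T \<theta> \<le> 1" using that False pos[OF that(1)] by auto
    ultimately show ?thesis using that pos[OF that(1)] sgn[OF that(1), of "t / T \<theta>"]
      by (auto simp: F_def intro!: exI[of _ "t / T \<theta>"])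
  qed
  have GF: "G (F (r *\<^sub>R \<theta>)) = r *\<^sub>R \<theta> \<and> F (r *\<^sub>R \<theta>) \<in> ?D" if "\<theta> \<in> \<Theta>" "0 \<le> r" "r \<le> 1" for r \<theta>
  proof (cases "r = 0")
    case True
    have "p = p + (0::real) *\<^sub>R \<theta>" by simp
    then show ?thesis using True that(1) pos[OF that(1)] by (force simp: F_def G_def)
  next
    case False
    then have "F (r *\<^sub>R \<theta>) = p + (T \<theta> * r) *\<^sub>R \<theta>"
      using that sgn[OF that(1), of r] by (simp add: F_def)
    moreover have "0 < T \<theta> * r" "T \<theta> * r \<le> T \<theta>" using that False pos[OF that(1)] by auto
    ultimately show ?thesis using that pos[OF that(1)] sgn[OF that(1), of "T \<theta> * r"]
      by (auto simp: G_def intro!: exI[of _ "T \<theta> * r"])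
  qed
  have "homeomorphism ?D ?B G F"
    using FG GF by (intro homeomorphismI contF contG) auto
  then show ?thesis unfolding homeomorphic_def by blast
qed

section \<open>Convexity of the direction cone\<close>

text \<open>The polar description hides convexity, whereas both sets on the right are convex. At
  least one direction must exist: for \<open>X = {p}\<close> the left side is empty and the right
  side is \<open>{0}\<close>.\<close>

lemma direction_cone_eq:
  assumes "convex X" "p \<in> X" "directions X p \<noteq> {}"
  shows "direction_cone X p = {z. \<exists>t>0. p + t *\<^sub>R z \<in> X} \<inter> cball 0 1"
proof (intro equalityI subsetI)
  fix z assume "z \<in> direction_cone X p"
  then obtain r \<theta> t where z: "z = r *\<^sub>R \<theta>" "0 \<le> r" "r \<le> 1" "norm \<theta> = 1"
    and t: "t > 0" "p + t *\<^sub>R \<theta> \<in> X"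
    by (auto simp: direction_cone_def directions_def)
  have "\<exists>t>0. p + t *\<^sub>R z \<in> X"
  proof (cases "r = 0")
    case True
    then show ?thesis using z assms(2) by (auto intro!: exI[of _ 1])
  next
    case False
    then show ?thesis using z t by (intro exI[of _ "t / r"]) auto
  qed
  then show "z \<in> {z. \<exists>t>0. p + t *\<^sub>R z \<in> X} \<inter> cball 0 1" using z by simp
next
  fix z assume "z \<in> {z. \<exists>t>0. p + t *\<^sub>R z \<in> X} \<inter> cball 0 1"
  then obtain t where t: "t > 0" "p + t *\<^sub>R z \<in> X" and z: "norm z \<le> 1" by auto
  show "z \<in> direction_cone X p"
  proof (cases "z = 0")
    case True
    obtain \<theta> where "\<theta> \<in> directions X p" using assms(3) by blast
    then show ?thesis using True
      unfolding direction_cone_def by (auto intro!: exI[of _ "0::real"] exI[of _ \<theta>])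
  next
    case False
    then have z_eq: "z = norm z *\<^sub>R sgn z" by (simp add: sgn_div_norm)
    then have "p + (t * norm z) *\<^sub>R sgn z \<in> X" using t by (metis scaleR_scaleR)
    then have "sgn z \<in> directions X p"
      using t False by (auto simp: directions_def norm_sgn intro!: exI[of _ "t * norm z"])
    moreover note z_eq
    ultimately show ?thesis using z unfolding direction_cone_def by force
  qed
qed

lemma convex_direction_cone:
  assumes "convex X" "p \<in> X" "directions X p \<noteq> {}"
  shows "convex (direction_cone X p)"
proof -
  have "convex {z. \<exists>t>0. p + t *\<^sub>R z \<in> X}"
  proof (rule convexI, clarsimp)
    fix x y :: 'a and u v t t' :: real
    assume uv: "0 \<le> u" "0 \<le> v" "u + v = 1" and t: "0 < t" "0 < t'"
      and X: "p + t *\<^sub>R x \<in> X" "p + t' *\<^sub>R y \<in> X"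
    \<comment> \<open>The weights \<open>a\<close>, \<open>b\<close> are chosen so that
      \<open>a * t\<close> and \<open>b * t'\<close> are \<open>u\<close> and \<open>v\<close> times
      the same factor \<open>t * t' / w\<close>; dividing by \<open>w\<close> makes them sum to
      1.\<close>
    define w where "w = u * t' + v * t"
    have w: "0 < w"
    proof (cases "u = 0")
      case False
      then show ?thesis using uv t by (simp add: w_def add_pos_nonneg)
    qed (use uv t in \<open>simp add: w_def\<close>)
    define a b where "a = u * t' / w" and "b = v * t / w"
    have ab: "0 \<le> a" "0 \<le> b" "a + b = 1"
      using uv t w by (auto simp: a_def b_def w_def simp flip: add_divide_distrib)
    have "a *\<^sub>R (p + t *\<^sub>R x) + b *\<^sub>R (p + t' *\<^sub>R y) \<in> X"
      using convexD[OF assms(1) X ab] .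
    moreover have "a *\<^sub>R (p + t *\<^sub>R x) + b *\<^sub>R (p + t' *\<^sub>R y)
        = (a + b) *\<^sub>R p + (t * t' / w) *\<^sub>R (u *\<^sub>R x + v *\<^sub>R y)"
      by (simp add: a_def b_def algebra_simps)
    ultimately have "p + (t * t' / w) *\<^sub>R (u *\<^sub>R x + v *\<^sub>R y) \<in> X" using ab by simp
    then show "\<exists>s>0. p + s *\<^sub>R (u *\<^sub>R x + v *\<^sub>R y) \<in> X"
      using t w by (intro exI[of _ "t * t' / w"]) simp
  qed
  then show ?thesis by (simp add: direction_cone_eq[OF assms] convex_Int)
qed

section \<open>Rays in \<open>X\<close> and in the dominance region\<close>

lemma ray_mem_convex:
  assumes "convex X" "p \<in> X" "p + t *\<^sub>R v \<in> X" "0 \<le> r" "r \<le> t"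
  shows "p + r *\<^sub>R v \<in> X"
proof (cases "t = 0")
  case False
  have "(1 - r / t) *\<^sub>R p + (r / t) *\<^sub>R (p + t *\<^sub>R v) \<in> X"
    using assms False by (intro convexD) auto
  moreover have "(1 - r / t) *\<^sub>R p + (r / t) *\<^sub>R (p + t *\<^sub>R v) = p + r *\<^sub>R v"
    using False by (simp add: algebra_simps)
  ultimately show ?thesis by simp
qed (use assms in auto)

lemma closed_ray_parameters:
  fixes p :: "'a::real_normed_vector"
  assumes "closed X"
  shows "closed {t. 0 \<le> t \<and> p + t *\<^sub>R v \<in> X}"
proof -
  have "closed ((\<lambda>t. p + t *\<^sub>R v) -` X)"
    by (rule closed_vimage[OF assms]) (auto intro!: continuous_intros)
  moreover have "{t. 0 \<le> t \<and> p + t *\<^sub>R v \<in> X} = {0..} \<inter> ((\<lambda>t. p + t *\<^sub>R v) -` X)" by auto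
  ultimately show ?thesis by (auto intro: closed_Int)
qed

text \<open>By convexity, a ray that has left \<open>X\<close> by parameter \<open>t\<close> has
  length at most \<open>t\<close>. Comparing the length in direction \<open>\<theta>\<close> only
  with the finite segment \<open>{0..T}\<close> treats finite and infinite lengths alike.\<close>

lemma emanation_eventually_mem:
  assumes "closed X" "convex X" "p \<in> X" and "emanation_in_direction X p \<theta>"
    and "p + T *\<^sub>R \<theta> \<in> X" and "0 < t" "t < T"
  shows "\<exists>\<beta>>0. \<forall>\<phi>\<in>directions X p. norm (\<phi> - \<theta>) < \<beta> \<longrightarrow> p + t *\<^sub>R \<phi> \<in> X"
proof -
  \<comment> \<open>Half the slack, so that \<open>T - \<epsilon>\<close> still exceeds
    \<open>t\<close> strictly.\<close>
  define \<epsilon> where "\<epsilon> = (T - t) / 2"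
  have \<epsilon>: "\<epsilon> > 0" using assms by (simp add: \<epsilon>_def)
  obtain \<beta> where "\<beta> > 0" and \<beta>: "\<And>\<phi>. \<phi> \<in> directions X p \<Longrightarrow> norm (\<phi> - \<theta>) < \<beta>
      \<Longrightarrow> ray_length X p \<phi> \<ge> ray_length X p \<theta> - ennreal \<epsilon>"
    using assms(4) \<epsilon> unfolding emanation_in_direction_def by blast
  have "p + t *\<^sub>R \<phi> \<in> X" if \<phi>: "\<phi> \<in> directions X p" "norm (\<phi> - \<theta>) < \<beta>" for \<phi>
  proof (rule ccontr)
    assume nin: "p + t *\<^sub>R \<phi> \<notin> X"
    have "{r. 0 \<le> r \<and> p + r *\<^sub>R \<phi> \<in> X} \<subseteq> {0..t}"
      using ray_mem_convex[OF assms(2,3)] nin assms(6) by (smt (verit) atLeastAtMost_iff mem_Collect_eq subsetI)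
    then have "ray_length X p \<phi> \<le> emeasure lborel {0..t}"
      unfolding ray_length_def by (intro emeasure_mono) auto
    then have "ray_length X p \<phi> \<le> ennreal t" using assms by simp
    moreover have "emeasure lborel {0..T} \<le> ray_length X p \<theta>"
      unfolding ray_length_def using ray_mem_convex[OF assms(2,3,5)]
      by (intro emeasure_mono) (auto intro!: borel_closed closed_ray_parameters assms)
    then have "ennreal T - ennreal \<epsilon> \<le> ray_length X p \<theta> - ennreal \<epsilon>"
      using assms by (intro ennreal_minus_mono) auto
    ultimately have "ennreal T - ennreal \<epsilon> \<le> ennreal t" using \<beta>[OF \<phi>] by order
    then have "T - \<epsilon> \<le> t" using \<epsilon> assms by (simp add: ennreal_minus)
    then show False using assms by (simp add: \<epsilon>_def field_simps)
  qed
  then show ?thesis using \<open>\<beta> > 0\<close> by blast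
qed

text \<open>Moving back towards \<open>p\<close> lowers the distance to \<open>p\<close> by exactly
  \<open>T - t\<close>, and the distance to \<open>A\<close> by at most that much.\<close>

lemma dominance_region_ray:
  assumes "convex X" "p \<in> X" "A \<noteq> {}" and \<theta>: "norm \<theta> = 1"
    and T: "p + T *\<^sub>R \<theta> \<in> dominance_region X p A" and t: "0 \<le> t" "t \<le> T"
  shows "p + t *\<^sub>R \<theta> \<in> dominance_region X p A"
proof -
  have "infdist (p + T *\<^sub>R \<theta>) A \<le> infdist (p + t *\<^sub>R \<theta>) A + dist (p + T *\<^sub>R \<theta>) (p + t *\<^sub>R \<theta>)"
    by (rule infdist_triangle)
  also have "dist (p + T *\<^sub>R \<theta>) (p + t *\<^sub>R \<theta>) = T - t"
    using \<theta> t by (simp add: dist_norm flip: scaleR_left_diff_distrib)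
  finally show ?thesis
    using T t \<theta> ray_mem_convex[OF assms(1,2), of T \<theta> t] by (auto simp: dominance_region_def dist_norm)
qed

lemma closed_dominance_region: "closed X \<Longrightarrow> closed (dominance_region X p A)"
proof -
  assume "closed X"
  moreover have "closed {x. dist x p \<le> infdist x A}"
    by (intro closed_Collect_le continuous_intros)
  moreover have "dominance_region X p A = X \<inter> {x. dist x p \<le> infdist x A}"
    by (auto simp: dominance_region_def)
  ultimately show ?thesis by (simp add: closed_Int)
qed

lemma convex_locally_path_connected:
  fixes S :: "'a::real_normed_vector set"
  assumes "convex S"
  shows "locally path_connected S"
proof (rule locallyI)
  fix w x assume "openin (top_of_set S) w" "x \<in> w"
  then obtain e where e: "e > 0" "ball x e \<inter> S \<subseteq> w" and xS: "x \<in> S"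
    unfolding openin_contains_ball by blast
  have "path_connected (ball x e \<inter> S)"
    by (intro convex_imp_path_connected convex_Int assms convex_ball)
  moreover have "openin (top_of_set S) (ball x e \<inter> S)"
    by (metis Int_commute open_ball openin_open_Int)
  ultimately show "\<exists>u v. openin (top_of_set S) u \<and> path_connected v \<and> x \<in> u \<and> u \<subseteq> v \<and> v \<subseteq> w"
    using e xS by (intro exI[of _ "ball x e \<inter> S"]) auto
qed

section \<open>The radial length function of the dominance region\<close>

theorem lemma5p1:
  fixes X A :: "'a::real_normed_vector set" and p :: 'a
  assumes "uniformly_convex TYPE('a)"
    and "closed X" and "convex X" and "p \<in> X"
    and "\<exists>s>0. \<forall>\<theta>\<in>directions X p. p + s *\<^sub>R \<theta> \<in> X"
    and "emanation_property X p"
    and "A \<noteq> {}" and "A \<subseteq> X" and "infdist p A > 0"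
    and "\<exists>\<rho>>0. \<forall>x\<in>X. ball x \<rho> \<inter> A \<noteq> {}"
  shows "dominance_region X p A homeomorphic direction_cone X p
    \<and> path_connected (dominance_region X p A)
    \<and> locally path_connected (dominance_region X p A)"
proof -
  obtain s where s: "s > 0" "\<And>\<theta>. \<theta> \<in> directions X p \<Longrightarrow> p + s *\<^sub>R \<theta> \<in> X" using assms(5) by blast
  obtain \<rho> where \<rho>: "\<rho> > 0" "\<And>x. x \<in> X \<Longrightarrow> ball x \<rho> \<inter> A \<noteq> {}" using assms(10) by blast
  let ?D = "dominance_region X p A" and ?\<Theta> = "directions X p"
  have unit: "norm \<theta> = 1" if "\<theta> \<in> ?\<Theta>" for \<theta> using that by (simp add: directions_def)
  have dir: "sgn (x - p) \<in> ?\<Theta>" if "x \<in> X" "x \<noteq> p" for x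
    using that by (auto simp: directions_def norm_sgn sgn_div_norm intro!: exI[of _ "norm (x - p)"])
  \<comment> \<open>Since \<open>d(p,A) > 0\<close>, a point of \<open>A\<close> differs from
    \<open>p\<close> and so provides a direction.\<close>
  obtain a where a: "a \<in> A" using assms(7) by blast
  moreover have "a \<noteq> p" using assms(9) infdist_zero[of p A] a by auto
  ultimately have ne: "?\<Theta> \<noteq> {}" using dir[of a] assms(8) by auto
  define T where "T \<theta> = Sup {t. 0 \<le> t \<and> p + t *\<^sub>R \<theta> \<in> ?D}" for \<theta>
  have bounded: "t \<le> \<rho>" if "\<theta> \<in> ?\<Theta>" "0 \<le> t" "p + t *\<^sub>R \<theta> \<in> ?D" for t \<theta>
  proof -
    have "p + t *\<^sub>R \<theta> \<in> X" using that by (simp add: dominance_region_def)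
    then obtain b where "b \<in> A" "dist (p + t *\<^sub>R \<theta>) b < \<rho>" using \<rho>(2) by (fastforce simp: ball_def)
    then have "infdist (p + t *\<^sub>R \<theta>) A < \<rho>" using infdist_le by (metis order.strict_trans1)
    then show ?thesis using that unit[of \<theta>] by (auto simp: dominance_region_def dist_norm)
  qed
  have T_iff: "p + t *\<^sub>R \<theta> \<in> ?D \<longleftrightarrow> t \<le> T \<theta>" if \<theta>: "\<theta> \<in> ?\<Theta>" and t: "0 \<le> t" for t \<theta>
  proof
    let ?S = "{t. 0 \<le> t \<and> p + t *\<^sub>R \<theta> \<in> ?D}"
    have bdd: "bdd_above ?S" using bounded[OF \<theta>] by (intro bdd_aboveI[of _ \<rho>]) auto
    show "t \<le> T \<theta>" if "p + t *\<^sub>R \<theta> \<in> ?D"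
      unfolding T_def using that t by (intro cSup_upper bdd) auto
    \<comment> \<open>The parameter set is nonempty, bounded and closed, so its supremum is
      attained; star-shapedness then fills in all smaller parameters.\<close>
    have "0 \<in> ?S" using assms(4) by (simp add: dominance_region_def infdist_nonneg)
    then have "T \<theta> \<in> ?S" unfolding T_def
      by (intro closed_contains_Sup bdd closed_ray_parameters closed_dominance_region assms) auto
    then show "p + t *\<^sub>R \<theta> \<in> ?D" if "t \<le> T \<theta>"
      using dominance_region_ray[OF assms(3,4,7) unit[OF \<theta>] _ t that] by simp
  qed
  \<comment> \<open>The bound \<open>s\<close> keeps the point at distance \<open>c\<close> inside
    \<open>X\<close>; half of \<open>infdist p A\<close> leaves its distance to \<open>A\<close> at
    least \<open>c\<close>.\<close>
  define c where "c = min s (infdist p A / 2)"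
  have c: "0 < c" using s assms(9) by (simp add: c_def)
  have c_le: "c \<le> T \<theta>" if \<theta>: "\<theta> \<in> ?\<Theta>" for \<theta>
  proof -
    have "infdist p A \<le> infdist (p + c *\<^sub>R \<theta>) A + dist p (p + c *\<^sub>R \<theta>)" by (rule infdist_triangle)
    then have "c \<le> infdist (p + c *\<^sub>R \<theta>) A" using c unit[OF \<theta>] by (auto simp: dist_norm c_def)
    moreover have "p + c *\<^sub>R \<theta> \<in> X"
      using c by (intro ray_mem_convex[OF assms(3,4) s(2)[OF \<theta>]]) (auto simp: c_def)
    ultimately have "p + c *\<^sub>R \<theta> \<in> ?D" using c unit[OF \<theta>] by (simp add: dominance_region_def dist_norm)
    then show ?thesis using T_iff \<theta> c by simp
  qed
  have T_mem: "p + T \<theta> *\<^sub>R \<theta> \<in> ?D" if "\<theta> \<in> ?\<Theta>" for \<theta>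
    using T_iff[OF that, of "T \<theta>"] c_le[OF that] c by simp
  have T_le: "T \<theta> \<le> \<rho>" if "\<theta> \<in> ?\<Theta>" for \<theta>
    using bounded[OF that _ T_mem[OF that]] c_le[OF that] c by simp
  have contT: "continuous_on ?\<Theta> T"
    unfolding continuous_on_def
  proof (intro ballI order_tendstoI)
    fix \<theta> u assume \<theta>: "\<theta> \<in> ?\<Theta>" and u: "T \<theta> < u"
    have u0: "0 \<le> u" using u c c_le[OF \<theta>] by linarith
    have "p + u *\<^sub>R \<theta> \<in> - ?D" using T_iff[OF \<theta> u0] u by simp
    moreover have "((\<lambda>\<phi>. p + u *\<^sub>R \<phi>) \<longlongrightarrow> p + u *\<^sub>R \<theta>) (at \<theta> within ?\<Theta>)"
      by (intro tendsto_intros)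
    ultimately have "\<forall>\<^sub>F \<phi> in at \<theta> within ?\<Theta>. p + u *\<^sub>R \<phi> \<in> - ?D"
      by (intro topological_tendstoD) (auto intro: closed_dominance_region assms)
    then show "\<forall>\<^sub>F \<phi> in at \<theta> within ?\<Theta>. T \<phi> < u"
      unfolding eventually_at_filter by eventually_elim (use T_iff u0 in force)
  next
    fix \<theta> l assume \<theta>: "\<theta> \<in> ?\<Theta>" and l: "l < T \<theta>"
    \<comment> \<open>The midpoint, with \<open>l\<close> replaced by 0 when negative, lies strictly
      between 0 and \<open>T \<theta>\<close>, as both the gap estimate and the emanation argument
      require.\<close>
    define t where "t = (max l 0 + T \<theta>) / 2"
    have t: "0 < t" "t < T \<theta>" "l < t" using l c c_le[OF \<theta>] by (auto simp: t_def max_def field_simps)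
    have X: "p + T \<theta> *\<^sub>R \<theta> \<in> X" and far: "T \<theta> \<le> infdist (p + T \<theta> *\<^sub>R \<theta>) A"
      using T_mem[OF \<theta>] unit[OF \<theta>] t by (auto simp: dominance_region_def dist_norm)
    obtain \<beta> where \<beta>: "\<beta> > 0" "\<And>\<phi>. \<phi> \<in> ?\<Theta> \<Longrightarrow> norm (\<phi> - \<theta>) < \<beta> \<Longrightarrow> p + t *\<^sub>R \<phi> \<in> X"
      using emanation_eventually_mem[OF assms(2-4) _ X t(1,2)] assms(6) \<theta>
      unfolding emanation_property_def by blast
    have "t < infdist (p + t *\<^sub>R \<theta>) A"
      by (rule uniformly_convex_infdist_segment_gap[OF assms(1,7,9) unit[OF \<theta>] t(1,2) far])
    moreover have "((\<lambda>\<phi>. infdist (p + t *\<^sub>R \<phi>) A) \<longlongrightarrow> infdist (p + t *\<^sub>R \<theta>) A) (at \<theta> within ?\<Theta>)"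
      by (intro tendsto_intros)
    ultimately have "\<forall>\<^sub>F \<phi> in at \<theta> within ?\<Theta>. t < infdist (p + t *\<^sub>R \<phi>) A"
      by (rule order_tendstoD[rotated])
    moreover have "\<forall>\<^sub>F \<phi> in at \<theta> within ?\<Theta>. \<phi> \<in> ?\<Theta> \<and> norm (\<phi> - \<theta>) < \<beta>"
      using \<beta>(1) by (auto simp: eventually_at dist_norm)
    ultimately show "\<forall>\<^sub>F \<phi> in at \<theta> within ?\<Theta>. l < T \<phi>"
    proof eventually_elim
      case (elim \<phi>)
      then have "p + t *\<^sub>R \<phi> \<in> ?D"
        using \<beta>(2) unit t by (simp add: dominance_region_def dist_norm)
      then show ?case using T_iff[of \<phi> t] elim t by simp
    qed
  qed
  have D_eq: "?D = {p + t *\<^sub>R \<theta> | t \<theta>. \<theta> \<in> ?\<Theta> \<and> 0 \<le> t \<and> t \<le> T \<theta>}"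
  proof (intro equalityI subsetI)
    fix x assume x: "x \<in> ?D"
    obtain \<theta> t where "\<theta> \<in> ?\<Theta>" "0 \<le> t" "x = p + t *\<^sub>R \<theta>"
    \<comment> \<open>The point \<open>p\<close> has no direction of its own; any direction with
      \<open>t = 0\<close> represents it.\<close>
    proof (cases "x = p")
      case True
      then show ?thesis using ne that[of _ 0] by auto
    next
      case False
      then show ?thesis
        using dir[of x] x that[of "sgn (x - p)" "norm (x - p)"]
        by (auto simp: dominance_region_def sgn_div_norm)
    qed
    then show "x \<in> {p + t *\<^sub>R \<theta> | t \<theta>. \<theta> \<in> ?\<Theta> \<and> 0 \<le> t \<and> t \<le> T \<theta>}"
      using x T_iff by blast
  qed (use T_iff in auto)
  have homeo: "?D homeomorphic direction_cone X p"
    unfolding D_eq direction_cone_def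
    using c_le T_le by (intro radial_homeomorphic_cone[OF unit contT c]) auto
  have conv: "convex (direction_cone X p)" by (rule convex_direction_cone[OF assms(3,4) ne])
  have "path_connected ?D"
    using homeomorphic_path_connectedness[OF homeo] convex_imp_path_connected[OF conv] by simp
  moreover have "locally path_connected ?D"
    using homeomorphic_locally[OF homeo, of path_connected path_connected]
      homeomorphic_path_connectedness convex_locally_path_connected[OF conv] by blast
  ultimately show ?thesis using homeo by blast
qed

end
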